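(* For $i=1,2,3$ and every $n\ge 0$, the number of partitions of $n$ into parts wherein (1) $2$ appears as a part at most $i-1$ times, (2) the total number of appearances of any two consecutive even numbers is at most $2$, and (3) odd numbers may appear as parts without restriction, equals the number of partitions of $n$ into parts not congruent to $0,\pm 2i \pmod{14}$.
   Context: A partition of $n$ is a finite multiset of positive integers (its parts) with sum $n$. Two consecutive even numbers are $2j$ and $2j+2$ with $j\ge 1$; their total number of appearances is the multiplicity of $2j$ plus the multiplicity of $2j+2$. *)

theory Defs
  imports "HOL-Library.Multiset" "HOL-Number_Theory.Cong"
begin

definition partitions_of :: "nat \<Rightarrow> nat multiset set" where
  "partitions_of n = {P. (\<forall>p \<in># P. 0 < p) \<and> \<Sum>\<^sub># P = n}"

text \<open>In particular, \<^const>\<open>card\<close> counts the elements of any set of partitions of a given number.\<close>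

lemma finite_partitions_of: "finite (partitions_of n)"
proof (rule finite_subset)
  show "partitions_of n \<subseteq> mset ` {xs. set xs \<subseteq> {..n} \<and> length xs \<le> n}"
  proof
    fix P assume P: "P \<in> partitions_of n"
    obtain xs where xs: "P = mset xs"
      by (metis ex_mset)
    have pos: "\<forall>x \<in> set xs. 0 < x" and sum: "sum_list xs = n"
      using P by (auto simp: partitions_of_def xs sum_mset_sum_list)
    have "length xs \<le> sum_list xs"
      using pos by (induction xs) auto
    moreover have "set xs \<subseteq> {..n}"
      using sum member_le_sum_list by fastforce
    ultimately show "P \<in> mset ` {xs. set xs \<subseteq> {..n} \<and> length xs \<le> n}"
      using xs sum by auto
  qed
  show "finite (mset ` {xs. set xs \<subseteq> {..n} \<and> length xs \<le> n})"
    by (intro finite_imageI finite_lists_length_le) simp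
qed

end

theory Submission
  imports Defs "HOL-Computational_Algebra.Formal_Power_Series"
begin

text \<open>
  Halving the even parts turns the conditions on them into Gordon's conditions: at most $i - 1$ ones,
  and at most $k - 1 = 2$ appearances of any two consecutive numbers. Gordon's theorem for $k = 3$
  counts such partitions by those into parts not congruent to $0, \pm i$ modulo $2k + 1 = 7$; doubling
  the parts again and adding arbitrary odd parts on both sides gives the claim. The proof below
  treats all $k$ and a dilation factor $d$ at once (theorem \<open>dilated_gordon\<close>) and carries the
  unrestricted parts along, so that no separate product of generating functions is needed.

  Gordon's theorem is proved by Andrews' method. Let $B_{i,m}$ be the generating function of the
  partitions in which any two consecutive multiples of $d$ appear at most $k - 1$ times in total, no
  multiple of $d$ up to $dm$ occurs, and $d(m+1)$ appears fewer than $i$ times.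
  Removing the copies of $d(m+1)$ when there are exactly $i - 1$ of them yields, with $q = X^d$,
  \[ B_{i,m} = B_{i-1,m} + q^{(m+1)(i-1)} B_{k+1-i,m+1}, \qquad B_{0,m} = 0 \]
  (lemma \<open>partition_gf_gordon_recurrence\<close>). Certain explicit alternating sums satisfy the same
  recurrence (lemma \<open>andrews_sum_recurrence\<close>). Modulo $q^N$ such a system is determined by its values at
  level $m = N$ (lemma \<open>recurrence_unique\<close>), and there both sides are easy to compute. At $m = 0$ the
  alternating sum is a theta series, which the Jacobi triple product (lemma
  \<open>truncated_triple_product\<close>) turns into the product over the multiples of $d$ in the forbidden
  residue classes.

  All infinite sums and products are truncated: every identity is a congruence modulo $q^N$ with
  $N$ arbitrary, so only finite algebra is needed, and a coefficient is read off by taking $N$ large.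
\<close>

section \<open>Congruences in a commutative ring\<close>

text \<open>
  Infinite sums and products are replaced by congruences modulo powers of \<open>q\<close>. For power series
  and \<open>m = X ^ N\<close> this is agreement of the coefficients below \<open>N\<close>.
\<close>

definition rcong :: "'a::comm_ring_1 \<Rightarrow> 'a \<Rightarrow> 'a \<Rightarrow> bool" where
  "rcong m a b \<longleftrightarrow> m dvd a - b"

lemma rcong_refl [simp]: "rcong m a a"
  by (simp add: rcong_def)

lemma rcong_sym: "rcong m a b \<Longrightarrow> rcong m b a"
  unfolding rcong_def by (subst minus_diff_eq[symmetric]) (simp only: dvd_minus_iff)

lemma rcong_trans [trans]: "rcong m a b \<Longrightarrow> rcong m b c \<Longrightarrow> rcong m a c"
  unfolding rcong_def using dvd_add[of m "a - b" "b - c"] by simp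

text \<open>
  Mixed transitivity with equations, so that calculations avoid higher-order substitution rules.
\<close>

lemma rcong_eq_trans [trans]: "rcong m a b \<Longrightarrow> b = c \<Longrightarrow> rcong m a c"
  by simp

lemma eq_rcong_trans [trans]: "a = b \<Longrightarrow> rcong m b c \<Longrightarrow> rcong m a c"
  by simp

lemma rcong_add: "rcong m a b \<Longrightarrow> rcong m c d \<Longrightarrow> rcong m (a + c) (b + d)"
  unfolding rcong_def using dvd_add[of m "a - b" "c - d"] by (simp add: algebra_simps)

lemma rcong_diff: "rcong m a b \<Longrightarrow> rcong m c d \<Longrightarrow> rcong m (a - c) (b - d)"
  unfolding rcong_def using dvd_diff[of m "a - b" "c - d"] by (simp add: algebra_simps)

lemma rcong_mult: "rcong m a b \<Longrightarrow> rcong m c d \<Longrightarrow> rcong m (a * c) (b * d)"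
proof -
  assume "rcong m a b" "rcong m c d"
  then have "m dvd (a - b) * c + b * (c - d)"
    by (simp add: rcong_def)
  then show ?thesis
    by (simp add: rcong_def algebra_simps)
qed

lemma rcong_sum: "(\<And>x. x \<in> A \<Longrightarrow> rcong m (f x) (g x)) \<Longrightarrow> rcong m (sum f A) (sum g A)"
  by (induction A rule: infinite_finite_induct) (auto intro: rcong_add)

lemma rcong_prod: "(\<And>x. x \<in> A \<Longrightarrow> rcong m (f x) (g x)) \<Longrightarrow> rcong m (prod f A) (prod g A)"
  by (induction A rule: infinite_finite_induct) (auto intro: rcong_mult)

lemma rcong_dvd: "rcong m a b \<Longrightarrow> m' dvd m \<Longrightarrow> rcong m' a b"
  using dvd_trans by (auto simp: rcong_def)

text \<open>
  An element \<^term>\<open>u = 1 - r\<close> with \<^term>\<open>q dvd r\<close> is a unit modulo every power of \<^term>\<open>q\<close>: its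
  inverse is the truncated geometric series in \<^term>\<open>r\<close>. This replaces division by infinite products.
\<close>

lemma rcong_cancel_one_minus:
  fixes q :: "'a::comm_ring_1"
  assumes "rcong q u 1" "rcong (q ^ N) (u * a) (u * b)"
  shows "rcong (q ^ N) a b"
proof -
  from assms(1) have "q dvd 1 - u"
    using rcong_sym by (simp add: rcong_def)
  then obtain w where w: "1 - u = q * w" ..
  define r where "r = q * w"
  have u: "u = 1 - r"
    using w by (simp add: r_def algebra_simps)
  have "r ^ N = 1 - (1 - r) * (\<Sum>j<N. r ^ j)"
    using one_diff_power_eq[of r N] by (simp add: algebra_simps)
  then have "r ^ N * (a - b) = (1 - (1 - r) * (\<Sum>j<N. r ^ j)) * (a - b)"
    by (simp only:)
  then have "a - b = r ^ N * (a - b) + (u * a - u * b) * (\<Sum>j<N. r ^ j)"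
    unfolding u by (simp only:) (simp add: algebra_simps)
  moreover have "q ^ N dvd r ^ N * (a - b)"
    by (simp add: r_def power_mult_distrib mult.assoc)
  moreover have "q ^ N dvd (u * a - u * b) * (\<Sum>j<N. r ^ j)"
    using assms(2) by (simp add: rcong_def)
  ultimately show ?thesis
    unfolding rcong_def using dvd_add by metis
qed

section \<open>Finite $q$-products\<close>

text \<open>
  The shifted factorial $(q^{a+1};q)_m$. The shift makes both ends extensible by one factor, which is
  how the terms of Andrews' sums are merged below.
\<close>

definition qprod :: "'a::comm_ring_1 \<Rightarrow> nat \<Rightarrow> nat \<Rightarrow> 'a" where
  "qprod q a m = (\<Prod>j<m. 1 - q ^ Suc (a + j))"

lemma qprod_0 [simp]: "qprod q a 0 = 1"
  by (simp add: qprod_def)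

lemma qprod_Suc: "qprod q a (Suc m) = qprod q a m * (1 - q ^ Suc (a + m))"
  by (simp add: qprod_def)

lemma qprod_Suc_shift: "qprod q a (Suc m) = (1 - q ^ Suc a) * qprod q (Suc a) m"
  by (simp only: qprod_def prod.lessThan_Suc_shift) simp

lemma qprod_add: "qprod q a (m + n) = qprod q a m * qprod q (a + m) n"
  by (induction n) (simp_all add: qprod_Suc add.assoc)

lemma rcong_qprod_1:
  assumes "N \<le> Suc a"
  shows "rcong (q ^ N) (qprod q a m) 1"
proof -
  have "rcong (q ^ N) (qprod q a m) (\<Prod>j<m. 1)"
    unfolding qprod_def using assms by (intro rcong_prod) (auto simp: rcong_def simp del: power_Suc intro!: le_imp_power_dvd)
  then show ?thesis by simp
qed

text \<open>
  Both sides approximate the infinite product $(q;q)_\infty$ to the given precision.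
\<close>

lemma rcong_qprod:
  assumes "N \<le> Suc m" "N \<le> Suc n"
  shows "rcong (q ^ N) (qprod q 0 m) (qprod q 0 n)"
proof -
  have *: "rcong (q ^ N) (qprod q 0 n) (qprod q 0 m)" if "m \<le> n" "N \<le> Suc m" for m n
  proof -
    have "qprod q 0 n = qprod q 0 m * qprod q m (n - m)"
      using qprod_add[of q 0 m "n - m"] that by simp
    then show ?thesis
      using rcong_mult[OF rcong_refl[of _ "qprod q 0 m"] rcong_qprod_1[of N m q "n - m"]] that by simp
  qed
  show ?thesis
    using assms *[of m n] *[of n m] by (cases "m \<le> n") (auto intro: rcong_sym)
qed

section \<open>Gaussian binomials\<close>

text \<open>
  The Gaussian binomial coefficient, given by the Pascal rule that matches splitting off the first
  factor of a product.
\<close>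

fun qbin :: "'a::comm_ring_1 \<Rightarrow> nat \<Rightarrow> nat \<Rightarrow> 'a" where
  "qbin q n 0 = 1"
| "qbin q 0 (Suc k) = 0"
| "qbin q (Suc n) (Suc k) = qbin q n k + q ^ Suc k * qbin q n (Suc k)"

lemma qbin_eq_0: "n < k \<Longrightarrow> qbin q n k = 0"
  by (induction q n k rule: qbin.induct) auto

lemma qbin_self [simp]: "qbin q n n = 1"
  by (induction n) (auto simp: qbin_eq_0)

text \<open>
  The quotient formula, with denominators cleared so that it holds in every commutative ring.
\<close>

lemma qbin_qprod: "qbin q (a + b) a * qprod q 0 a * qprod q 0 b = qprod q 0 (a + b)"
proof (induction "a + b" arbitrary: a b)
  case 0
  then show ?case by simp
next
  case (Suc n)
  show ?case
  proof (cases a)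
    case 0
    then show ?thesis by simp
  next
    case a: (Suc a')
    show ?thesis
    proof (cases b)
      case 0
      then show ?thesis by simp
    next
      case b: (Suc b')
      have "qbin q (a + b) a * qprod q 0 a * qprod q 0 b
          = (1 - q ^ a) * (qbin q (a' + b) a' * qprod q 0 a' * qprod q 0 b)
          + q ^ a * (1 - q ^ b) * (qbin q (a + b') a * qprod q 0 a * qprod q 0 b')"
        by (simp add: a b qprod_Suc algebra_simps)
      also have "\<dots> = ((1 - q ^ a) + q ^ a * (1 - q ^ b)) * qprod q 0 (a + b')"
        using Suc.hyps(1)[of a' b] Suc.hyps(1)[of a b'] Suc.hyps(2) a b
        by (simp add: distrib_right)
      also have "\<dots> = qprod q 0 (a + b)"
        by (simp add: b qprod_Suc algebra_simps power_add)
      finally show ?thesis .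
    qed
  qed
qed

text \<open>
  The binomial coefficient $\binom{n}{2}$, in a form free of division.
\<close>

definition tri :: "nat \<Rightarrow> nat" where "tri n = (\<Sum>j<n. j)"

lemma tri_0 [simp]: "tri 0 = 0"
  by (simp add: tri_def)

lemma tri_Suc [simp]: "tri (Suc n) = tri n + n"
  by (simp add: tri_def)

lemma tri_add: "tri (m + n) = tri m + tri n + m * n"
  by (induction n) auto

text \<open>
  Splitting off the factor with \<^term>\<open>j = (0::nat)\<close> leaves the same product with \<^term>\<open>b\<close> replaced
  by \<^term>\<open>b * q\<close>, so the induction runs over all \<^term>\<open>b\<close> and meets exactly the recursion of
  \<^const>\<open>qbin\<close>.
\<close>

lemma q_binomial_theorem:
  fixes a b q :: "'a::comm_ring_1"
  shows "(\<Prod>j<n. a + b * q ^ j) = (\<Sum>j\<le>n. a ^ (n - j) * b ^ j * q ^ tri j * qbin q n j)"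
proof (induction n arbitrary: b)
  case 0
  then show ?case by simp
next
  case (Suc n)
  define S where "S = (\<lambda>j. a ^ (n - j) * b ^ j * q ^ (tri j + j) * qbin q n j)"
  have "(\<Prod>j<Suc n. a + b * q ^ j) = (a + b) * (\<Prod>j<n. a + (b * q) * q ^ j)"
    by (simp only: prod.lessThan_Suc_shift) (simp add: mult.assoc)
  also have "(\<Prod>j<n. a + (b * q) * q ^ j) = (\<Sum>j\<le>n. S j)"
    by (simp only: Suc.IH S_def) (simp add: power_mult_distrib power_add mult_ac)
  also have "(a + b) * (\<Sum>j\<le>n. S j) = a * S 0 + (\<Sum>j<n. a * S (Suc j)) + b * (\<Sum>j\<le>n. S j)"
    by (simp only: distrib_right sum.atMost_shift) (simp add: distrib_left sum_distrib_left)
  also have "\<dots> = a * S 0 + (\<Sum>j\<le>n. (if j < n then a * S (Suc j) else 0) + b * S j)"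
    by (simp add: sum.distrib sum_distrib_left sum.If_cases lessThan_def[symmetric])
       (auto simp: lessThan_def Int_def intro!: sum.cong)
  also have "\<dots> = (\<Sum>j\<le>Suc n. a ^ (Suc n - j) * b ^ j * q ^ tri j * qbin q (Suc n) j)"
    unfolding sum.atMost_Suc_shift
  proof (intro arg_cong2[where f = "(+)"] sum.cong refl)
    show "a * S 0 = a ^ (Suc n - 0) * b ^ 0 * q ^ tri 0 * qbin q (Suc n) 0"
      by (simp add: S_def)
    fix j assume "j \<in> {..n}"
    show "(if j < n then a * S (Suc j) else 0) + b * S j =
          a ^ (Suc n - Suc j) * b ^ Suc j * q ^ tri (Suc j) * qbin q (Suc n) (Suc j)"
    proof (cases "j < n")
      case True
      then have "n - j = Suc (n - Suc j)" by simp
      then show ?thesis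
        using True by (simp add: S_def power_add algebra_simps)
    next
      case False
      then have "j = n" using \<open>j \<in> {..n}\<close> by simp
      then show ?thesis
        by (simp add: S_def power_add qbin_eq_0 algebra_simps)
    qed
  qed
  finally show ?case .
qed

section \<open>The Jacobi triple product\<close>

text \<open>
  Cauchy's argument: expand $\prod_{j<2N}(y p^{N-1} - p^j)$ by the $q$-binomial theorem. As
  \<^term>\<open>p = x * y\<close>, the lower half of the factors gives the product in \<^term>\<open>y\<close> (in reverse order)
  and the upper half the product in \<^term>\<open>x\<close>, each up to a monomial. The common monomial \<open>D\<close> is
  cancelled at the end. Writing $x$ and $p/x = y$ separately keeps all exponents nonnegative; the
  terms on either side of the middle one carry the powers of \<^term>\<open>x\<close> and of \<^term>\<open>y\<close>.
\<close>

lemma finite_triple_product: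
  fixes x y :: "'a::idom"
  defines "p \<equiv> x * y"
  assumes "x \<noteq> 0" "y \<noteq> 0"
  shows "(\<Prod>j<N. (1 - x * p ^ j) * (1 - y * p ^ j)) =
    qbin p (2 * N) N + (\<Sum>n<N. (-1) ^ Suc n * p ^ tri (Suc n) *
      (x ^ Suc n * qbin p (2 * N) (N + Suc n) + y ^ Suc n * qbin p (2 * N) (N - Suc n)))"
  (is "?L = ?R")
proof -
  define T where "T = (\<lambda>j. (y * p ^ (N - 1)) ^ (2 * N - j) * (-1) ^ j * p ^ tri j * qbin p (2 * N) j)"
  define D where "D = (-1) ^ N * p ^ tri N * (y * p ^ (N - 1)) ^ N"
  have D0: "D \<noteq> 0"
    using assms by (simp add: D_def)
  have pp: "(\<Prod>j<N. p ^ j) = p ^ tri N"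
    by (simp add: tri_def power_sum)
  have "(\<Prod>j<2 * N. y * p ^ (N - 1) + (-1) * p ^ j)
      = (\<Prod>j<N. y * p ^ (N - 1) + (-1) * p ^ j) * (\<Prod>j<N. y * p ^ (N - 1) + (-1) * p ^ (N + j))"
  proof -
    have "(\<Prod>j<N + M. f j) = (\<Prod>j<N. f j) * (\<Prod>j<M. f (N + j))" for M and f :: "nat \<Rightarrow> 'a"
      by (induction M) (simp_all add: mult_ac)
    from this[of _ N] show ?thesis by (simp add: mult_2)
  qed
  also have "(\<Prod>j<N. y * p ^ (N - 1) + (-1) * p ^ (N + j)) = (\<Prod>j<N. (y * p ^ (N - 1)) * (1 - x * p ^ j))"
  proof (intro prod.cong refl)
    fix j assume "j \<in> {..<N}"
    then obtain M where "N = Suc M" by (cases N) auto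
    then show "y * p ^ (N - 1) + (-1) * p ^ (N + j) = (y * p ^ (N - 1)) * (1 - x * p ^ j)"
      by (simp add: power_add algebra_simps) (simp add: p_def)
  qed
  also have "\<dots> = (y * p ^ (N - 1)) ^ N * (\<Prod>j<N. 1 - x * p ^ j)"
    by (simp add: prod.distrib)
  also have "(\<Prod>j<N. y * p ^ (N - 1) + (-1) * p ^ j) = (\<Prod>j<N. (- 1) * p ^ j * (1 - y * p ^ (N - Suc j)))"
  proof (intro prod.cong refl)
    fix j assume "j \<in> {..<N}"
    then have "N - 1 = j + (N - Suc j)" by simp
    then have "p ^ (N - 1) = p ^ j * p ^ (N - Suc j)"
      by (simp only: power_add)
    then show "y * p ^ (N - 1) + (-1) * p ^ j = (- 1) * p ^ j * (1 - y * p ^ (N - Suc j))"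
      by (simp add: algebra_simps)
  qed
  also have "\<dots> = (-1) ^ N * p ^ tri N * (\<Prod>j<N. 1 - y * p ^ (N - Suc j))"
    by (simp only: prod.distrib pp) simp
  also have "(\<Prod>j<N. 1 - y * p ^ (N - Suc j)) = (\<Prod>j<N. 1 - y * p ^ j)"
    by (rule prod.nat_diff_reindex)
  finally have L: "(\<Prod>j<2 * N. y * p ^ (N - 1) + (-1) * p ^ j) = D * ?L"
    by (simp add: D_def prod.distrib mult_ac)

  have T0: "T N = D * qbin p (2 * N) N"
    by (simp add: T_def D_def mult_2 algebra_simps)
  have Tp: "T (N + Suc n) = D * ((-1) ^ Suc n * p ^ tri (Suc n) * (x ^ Suc n * qbin p (2 * N) (N + Suc n)))"
    if "n < N" for n
  proof -
    define r where "r = N - Suc n"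
    have N: "N = r + Suc n" using that by (simp add: r_def)
    have e: "2 * N - (N + Suc n) = r" "N - 1 = r + n"
      using N by auto
    have xyp: "x * y * p ^ (N - 1) = p ^ N"
      by (simp add: N p_def[symmetric])
    have "(y * p ^ (r + n)) ^ r * p ^ (N * Suc n) = (y * p ^ (r + n)) ^ r * (x * y * p ^ (N - 1)) ^ Suc n"
      by (simp only: xyp power_mult)
    also have "\<dots> = (y * p ^ (N - 1)) ^ N * x ^ Suc n"
      by (simp add: N power_add power_mult_distrib mult_ac)
    finally have *: "(y * p ^ (r + n)) ^ r * p ^ (N * Suc n) = (y * p ^ (N - 1)) ^ N * x ^ Suc n" .
    have "T (N + Suc n) = (-1) ^ N * (-1) ^ Suc n * p ^ tri N * p ^ tri (Suc n)
        * ((y * p ^ (r + n)) ^ r * p ^ (N * Suc n)) * qbin p (2 * N) (N + Suc n)"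
      unfolding T_def tri_add e by (simp only: power_add mult_ac)
    then show ?thesis
      unfolding * D_def by (simp only: mult_ac)
  qed
  have Tm: "T (N - Suc n) = D * ((-1) ^ Suc n * p ^ tri (Suc n) * (y ^ Suc n * qbin p (2 * N) (N - Suc n)))"
    if "n < N" for n
  proof -
    define r where "r = N - Suc n"
    have N: "N = r + Suc n" using that by (simp add: r_def)
    have e: "2 * N - r = N + Suc n" "N - Suc n = r" "N - 1 = r + n"
      using N by auto
    have e2: "(r + n) * Suc n + tri r = tri N + tri (Suc n)"
    proof -
      have "n * n = 2 * tri n + n" by (induction n) auto
      then show ?thesis unfolding N tri_add by (simp add: algebra_simps)
    qed
    have "(y * p ^ (r + n)) ^ Suc n = y ^ Suc n * p ^ ((r + n) * Suc n)"
      by (simp only: power_mult_distrib power_mult)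
    then have "(y * p ^ (r + n)) ^ (N + Suc n) * p ^ tri r
       = (y * p ^ (r + n)) ^ N * y ^ Suc n * (p ^ ((r + n) * Suc n + tri r))"
      by (simp only: power_add[of _ N] power_add[of p _ "tri r"] mult_ac)
    then have *: "(y * p ^ (r + n)) ^ (N + Suc n) * p ^ tri r
       = (y * p ^ (r + n)) ^ N * y ^ Suc n * (p ^ tri N * p ^ tri (Suc n))"
      unfolding e2 by (simp only: power_add)
    have s: "(-1) ^ r = (-1) ^ N * ((-1) ^ Suc n :: 'a)"
      by (simp add: N power_add)
    have "T (N - Suc n) = (-1) ^ r * ((y * p ^ (r + n)) ^ (N + Suc n) * p ^ tri r) * qbin p (2 * N) (N - Suc n)"
      unfolding T_def e by (simp only: mult_ac)
    then show ?thesis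
      unfolding * s D_def e by (simp only: mult_ac)
  qed
  have "(\<Sum>j\<le>2 * N. T j) = T N + (\<Sum>n<N. T (N + Suc n) + T (N - Suc n))"
  proof -
    have a: "(\<Sum>j\<le>N + M. T j) = (\<Sum>j\<le>N. T j) + (\<Sum>n<M. T (N + Suc n))" for M
      by (induction M) (simp_all add: add_ac)
    have "(\<Sum>j\<le>N. T j) = (\<Sum>j<N. T j) + T N"
      by (simp add: lessThan_Suc_atMost[symmetric])
    also have "(\<Sum>j<N. T j) = (\<Sum>n<N. T (N - Suc n))"
      by (rule sum.nat_diff_reindex[symmetric])
    finally show ?thesis
      using a[of N] by (simp add: mult_2 sum.distrib add_ac)
  qed
  also have "\<dots> = D * qbin p (2 * N) N + (\<Sum>n<N. D * ((-1) ^ Suc n * p ^ tri (Suc n) *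
      (x ^ Suc n * qbin p (2 * N) (N + Suc n) + y ^ Suc n * qbin p (2 * N) (N - Suc n))))"
    using Tp Tm T0 by (auto simp: distrib_left intro!: sum.cong simp del: power_Suc)
  also have "\<dots> = D * ?R"
    by (simp only: distrib_left sum_distrib_left)
  finally have "D * ?L = D * ?R"
    using L by (simp only: q_binomial_theorem T_def)
  then show ?thesis
    using D0 by (simp only: mult_cancel_left) simp
qed

text \<open>
  For large \<^term>\<open>a\<close> and \<^term>\<open>b\<close> the three factorials in the quotient formula all agree with the
  same unit to the given precision, so the Gaussian binomial is the inverse of that unit.
\<close>

lemma rcong_qbin:
  assumes "N \<le> Suc a" "N \<le> Suc b" "N \<le> Suc c"
  shows "rcong (q ^ N) (qprod q 0 c * qbin q (a + b) a) 1"
proof -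
  define u where "u = qprod q 0 c"
  have u: "rcong (q ^ N) (qprod q 0 m) u" if "N \<le> Suc m" for m
    using that assms by (auto simp: u_def intro: rcong_qprod)
  have "rcong (q ^ N) (qbin q (a + b) a * u * u) (qbin q (a + b) a * qprod q 0 a * qprod q 0 b)"
    using assms by (intro rcong_mult rcong_refl rcong_sym[OF u])
  also have "\<dots> = qprod q 0 (a + b)" by (rule qbin_qprod)
  also have "rcong (q ^ N) \<dots> u"
    using assms by (intro u) simp
  finally have "rcong (q ^ N) (u * (u * qbin q (a + b) a)) (u * 1)"
    by (simp add: mult_ac)
  moreover have "rcong q u 1"
    using rcong_qprod_1[of 1 0 q c] by (simp add: u_def)
  ultimately show ?thesis
    unfolding u_def[symmetric] by (rule rcong_cancel_one_minus[rotated])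
qed

text \<open>
  Multiplied by \<^term>\<open>qprod p 0 N\<close>, the Gaussian binomials at distance \<^term>\<open>Suc n\<close> from the middle are
  congruent to 1 only modulo \<^term>\<open>p ^ (N - n)\<close>. Their coefficient \<^term>\<open>p ^ tri (Suc n)\<close> supplies the
  missing powers, because \<^term>\<open>n \<le> tri (Suc n)\<close>.
\<close>

lemma truncated_triple_product:
  fixes x y :: "'a::idom"
  defines "p \<equiv> x * y"
  assumes "x \<noteq> 0" "y \<noteq> 0"
  shows "rcong (p ^ N) (\<Prod>j<N. (1 - x * p ^ j) * (1 - y * p ^ j) * (1 - p ^ Suc j))
    (1 + (\<Sum>n<N. (-1) ^ Suc n * p ^ tri (Suc n) * (x ^ Suc n + y ^ Suc n)))"
proof -
  define u where "u = qprod p 0 N"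
  have t: "n \<le> tri (Suc n)" for n by simp
  have bin: "rcong (p ^ N) (p ^ tri (Suc n) * (u * qbin p (2 * N) j)) (p ^ tri (Suc n))"
    if "n < N" "j = N + Suc n \<or> j = N - Suc n" for n j
  proof -
    have "rcong (p ^ (N - n)) (qprod p 0 N * qbin p (j + (2 * N - j)) j) 1"
      using that by (intro rcong_qbin) auto
    moreover have "j + (2 * N - j) = 2 * N" using that by auto
    ultimately have "p ^ tri (Suc n) * p ^ (N - n) dvd p ^ tri (Suc n) * (u * qbin p (2 * N) j - 1)"
      unfolding u_def rcong_def by (intro mult_dvd_mono dvd_refl) simp
    moreover have "p ^ N dvd p ^ tri (Suc n) * p ^ (N - n)"
      unfolding power_add[symmetric] using t[of n] that by (intro le_imp_power_dvd) linarith
    ultimately show ?thesis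
      unfolding rcong_def by (simp add: right_diff_distrib dvd_trans)
  qed
  have "(\<Prod>j<N. (1 - x * p ^ j) * (1 - y * p ^ j) * (1 - p ^ Suc j))
      = u * (\<Prod>j<N. (1 - x * p ^ j) * (1 - y * p ^ j))"
    by (simp add: u_def qprod_def prod.distrib mult_ac)
  also have "\<dots> = u * qbin p (2 * N) N + (\<Sum>n<N. (-1) ^ Suc n * 
      (x ^ Suc n * (p ^ tri (Suc n) * (u * qbin p (2 * N) (N + Suc n)))
      + y ^ Suc n * (p ^ tri (Suc n) * (u * qbin p (2 * N) (N - Suc n)))))"
    using finite_triple_product[OF assms(2,3), of N] unfolding p_def[symmetric]
    by (simp only: distrib_left sum_distrib_left mult_ac)
  also have "rcong (p ^ N) \<dots> (1 + (\<Sum>n<N. (-1) ^ Suc n * 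
      (x ^ Suc n * p ^ tri (Suc n) + y ^ Suc n * p ^ tri (Suc n))))"
  proof (intro rcong_add rcong_sum rcong_mult rcong_refl bin)
    show "rcong (p ^ N) (u * qbin p (2 * N) N) 1"
      using rcong_qbin[of N N N N p] by (simp add: u_def mult_2)
  qed auto
  also have "\<dots> = 1 + (\<Sum>n<N. (-1) ^ Suc n * p ^ tri (Suc n) * (x ^ Suc n + y ^ Suc n))"
    by (simp add: algebra_simps)
  finally show ?thesis .
qed

section \<open>Andrews' alternating sums and their recurrence\<close>

text \<open>
  Andrews' function $J_{k,i}(0;x;q)$ at $x = q^m$, multiplied by $(q;q)_\infty$; this turns the
  denominators $(q;q)_n (q^{m+n+1};q)_\infty$ into the finite product \<^term>\<open>qprod q n m\<close>. The usual
  exponent $kmn + (2k+1)n(n+1)/2 - in$ is rearranged into a sum of nonnegative terms.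
\<close>

definition andrews_term :: "'a::comm_ring_1 \<Rightarrow> nat \<Rightarrow> nat \<Rightarrow> nat \<Rightarrow> nat \<Rightarrow> 'a" where
  "andrews_term q k i m n =
     (-1) ^ n * q ^ (k * n * (m + n) + (k - i) * n + tri (Suc n)) * (1 - q ^ ((m + 2 * n + 1) * i)) * qprod q n m"

definition andrews_sum :: "'a::comm_ring_1 \<Rightarrow> nat \<Rightarrow> nat \<Rightarrow> nat \<Rightarrow> nat \<Rightarrow> 'a" where
  "andrews_sum q k i m N = (\<Sum>n<N. andrews_term q k i m n)"

lemma andrews_sum_0 [simp]: "andrews_sum q k 0 m N = 0"
  by (simp add: andrews_sum_def andrews_term_def)

text \<open>
  The difference of the terms for \<^term>\<open>i\<close> and \<^term>\<open>i - 1\<close> splits into two parts \<open>a n + b n\<close>, in which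
  the factors $1 - q^n$ and $1 - q^{m+n+1}$ extend the finite product at its two ends. Pairing
  \<open>b n\<close> with \<open>a (Suc n)\<close> instead gives the terms of the sum for \<^term>\<open>k + 1 - i\<close> and \<^term>\<open>Suc m\<close>.
  Since \<open>a 0 = 0\<close>, truncation costs only the boundary term \<open>a N\<close>, a multiple of \<^term>\<open>q ^ N\<close>.
\<close>

lemma andrews_sum_recurrence:
  assumes "1 \<le> i" "i \<le> k"
  shows "rcong (q ^ N) (andrews_sum q k i m N)
    (andrews_sum q k (i - 1) m N + q ^ (Suc m * (i - 1)) * andrews_sum q k (k + 1 - i) (Suc m) N)"
proof -
  define j c where "j = i - 1" and "c = k - i"
  have i: "i = Suc j" and k: "k = Suc (c + j)"
    using assms by (auto simp: j_def c_def)
  have ki: "k - Suc j = c" "k - j = Suc c" "k + 1 - i = Suc c" "k - Suc c = j"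
    by (auto simp: k i)
  define a where "a = (\<lambda>n. (-1) ^ n * q ^ (k * n * (m + n) + c * n + tri (Suc n)) * (1 - q ^ n) * qprod q n m)"
  define b where "b = (\<lambda>n. (-1) ^ n * q ^ (k * n * (m + n) + Suc c * n + (m + 2 * n + 1) * j + tri (Suc n))
                      * qprod q n (Suc m))"
  have 1: "andrews_term q k i m n = andrews_term q k j m n + (a n + b n)" for n
    unfolding andrews_term_def a_def b_def i ki qprod_Suc
    by (simp add: algebra_simps power_add mult_2_right)
  have 2: "b n + a (Suc n) = q ^ (Suc m * j) * andrews_term q k (Suc c) (Suc m) n" for n
  proof -
    define P where "P = (-1) ^ n * q ^ tri (Suc n) * qprod q n (Suc m)"
    define S F H where "S = Suc m * j" and "F = k * n * (Suc m + n) + j * n"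
      and "H = (Suc m + 2 * n + 1) * Suc c"
    have eb: "k * n * (m + n) + Suc c * n + (m + 2 * n + 1) * j = S + F"
      by (simp add: S_def F_def k algebra_simps)
    have ea: "k * Suc n * (m + Suc n) + c * Suc n + Suc n = S + F + H"
      by (simp add: S_def F_def H_def k algebra_simps)
    have "b n = q ^ (S + F) * P"
      unfolding b_def eb P_def by (simp only: power_add mult_ac)
    moreover have "a (Suc n) = - (q ^ (S + F + H) * P)"
    proof -
      have "a (Suc n) = - (q ^ (k * Suc n * (m + Suc n) + c * Suc n + Suc n) * P)"
        unfolding a_def P_def qprod_Suc_shift power_add tri_Suc[of "Suc n"] power_Suc[of "-1"]
        by (simp only: mult_ac mult_minus_left mult_minus_right mult_1_left)
      then show ?thesis by (simp only: ea)
    qed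
    moreover have "andrews_term q k (Suc c) (Suc m) n = q ^ F * (1 - q ^ H) * P"
      unfolding andrews_term_def ki P_def H_def F_def by (simp only: power_add mult_ac)
    ultimately show ?thesis
      unfolding S_def[symmetric] by (simp only:) (simp add: power_add algebra_simps)
  qed
  have "andrews_sum q k i m N = andrews_sum q k j m N + (\<Sum>n<N. a n + b n)"
    by (simp add: andrews_sum_def 1 sum.distrib)
  also have "(\<Sum>n<N. a n + b n) = (\<Sum>n<N. b n + a (Suc n)) - a N"
    by (induction N) (simp_all add: a_def)
  also have "(\<Sum>n<N. b n + a (Suc n)) = q ^ (Suc m * j) * andrews_sum q k (Suc c) (Suc m) N"
    by (simp only: 2 andrews_sum_def sum_distrib_left)
  finally have "andrews_sum q k i m N = andrews_sum q k j m N
      + q ^ (Suc m * j) * andrews_sum q k (Suc c) (Suc m) N - a N"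
    by (simp add: algebra_simps)
  moreover have "q ^ N dvd a N"
  proof -
    have "q ^ N dvd q ^ (k * N * (m + N) + c * N + tri (Suc N))"
      by (intro le_imp_power_dvd) simp
    then show ?thesis
      by (simp add: a_def)
  qed
  ultimately show ?thesis
    unfolding rcong_def ki j_def[symmetric] by simp
qed

text \<open>
  The summands with \<^term>\<open>n > (0::nat)\<close> are multiples of \<^term>\<open>q ^ N\<close>, and so is the subtracted half
  of the first one.
\<close>

lemma andrews_sum_initial:
  assumes "1 \<le> i" "i \<le> k"
  shows "rcong (q ^ N) (andrews_sum q k i N N) (qprod q 0 N)"
proof (cases N)
  case 0
  then show ?thesis by (simp add: rcong_def)
next
  case (Suc N')
  have "rcong (q ^ N) (andrews_sum q k i N N) (\<Sum>n<N. if n = 0 then qprod q 0 N else 0)"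
    unfolding andrews_sum_def
  proof (intro rcong_sum)
    fix n
    show "rcong (q ^ N) (andrews_term q k i N n) (if n = 0 then qprod q 0 N else 0)"
    proof (cases "n = 0")
      case True
      have "q ^ N dvd q ^ ((N + 1) * i) * qprod q 0 N"
        using assms by (intro dvd_mult2 le_imp_power_dvd) (cases i; simp)
      then show ?thesis
        using True by (simp add: andrews_term_def rcong_def left_diff_distrib)
    next
      case False
      have "N \<le> k * n * (N + n) + (k - i) * n + tri (Suc n)"
        using False assms by (cases k; cases n) auto
      then have "q ^ N dvd q ^ (k * n * (N + n) + (k - i) * n + tri (Suc n))"
        by (rule le_imp_power_dvd)
      then show ?thesis
        using False by (simp add: andrews_term_def rcong_def)
    qed
  qed
  also have "\<dots> = qprod q 0 N"
    by (simp add: Suc)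
  finally show ?thesis .
qed

text \<open>
  The recurrence expresses level \<^term>\<open>m\<close> by level \<^term>\<open>Suc m\<close> and by smaller \<^term>\<open>i\<close>, so agreement
  at one level \<^term>\<open>N\<close> descends to all levels below it.
\<close>

lemma recurrence_unique:
  fixes q :: "'a::comm_ring_1" and f g :: "nat \<Rightarrow> nat \<Rightarrow> 'a"
  assumes init: "\<And>i. 1 \<le> i \<Longrightarrow> i \<le> k \<Longrightarrow> rcong M (f i N) (g i N)"
    and zero: "\<And>m. rcong M (f 0 m) (g 0 m)"
    and f: "\<And>i m. 1 \<le> i \<Longrightarrow> i \<le> k \<Longrightarrow> rcong M (f i m) (f (i - 1) m + q ^ (Suc m * (i - 1)) * f (k + 1 - i) (Suc m))"
    and g: "\<And>i m. 1 \<le> i \<Longrightarrow> i \<le> k \<Longrightarrow> rcong M (g i m) (g (i - 1) m + q ^ (Suc m * (i - 1)) * g (k + 1 - i) (Suc m))"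
    and "m \<le> N" "i \<le> k"
  shows "rcong M (f i m) (g i m)"
  using \<open>m \<le> N\<close> \<open>i \<le> k\<close>
proof (induction m arbitrary: i rule: inc_induct)
  case base
  then show ?case
    using init[of i] zero[of N] by (cases "i = 0") auto
next
  case (step m)
  show ?case
    using step.prems
  proof (induction i)
    case 0
    show ?case by (rule zero)
  next
    case (Suc i)
    have "rcong M (f (Suc i) m) (f i m + q ^ (Suc m * i) * f (k - i) (Suc m))"
      using f[of "Suc i" m] Suc.prems by simp
    also have "rcong M \<dots> (g i m + q ^ (Suc m * i) * g (k - i) (Suc m))"
      using Suc by (intro rcong_add rcong_mult rcong_refl step.IH) auto
    also have "rcong M \<dots> (g (Suc i) m)"
      using rcong_sym[OF g[of "Suc i" m]] Suc.prems by simp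
    finally show ?case .
  qed
qed

text \<open>
  At \<^term>\<open>m = (0::nat)\<close> the finite products disappear. The two halves of the \<^term>\<open>n\<close>-th summand are
  the term \<open>Y n\<close> and the term \<open>X (Suc n)\<close> of the two one-sided parts of the theta series with
  $x = q^i$ and $y = q^{K-i}$. The summand \<open>Y N\<close>, which the triple product has in addition, is
  negligible.
\<close>

lemma andrews_sum_triple_product:
  fixes q :: "'a::idom"
  assumes "q \<noteq> 0" "1 \<le> i" "i \<le> k"
  defines "K \<equiv> 2 * k + 1"
  shows "rcong (q ^ N) (andrews_sum q k i 0 N)
    (\<Prod>j<N. (1 - q ^ (K * j + i)) * (1 - q ^ (K * j + (K - i))) * (1 - q ^ (K * Suc j)))"
proof -
  define x y where "x = q ^ i" and "y = q ^ (K - i)"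
  have iK: "i + (K - i) = K" and K: "1 \<le> K - i" "K \<ge> 1"
    using assms by (auto simp: K_def)
  have p: "x * y = q ^ K"
    by (simp add: x_def y_def iK flip: power_add)
  define X where "X = (\<lambda>n. (-1) ^ n * (x * y) ^ tri n * x ^ n)"
  define Y where "Y = (\<lambda>n. (-1) ^ n * (x * y) ^ tri n * y ^ n)"
  have split: "andrews_term q k i 0 n = Y n + X (Suc n)" for n
  proof -
    define c where "c = k - i"
    have k: "k = i + c" using assms by (simp add: c_def)
    have Ki: "K - i = i + 2 * c + 1" by (simp add: K_def k)
    have nn: "n * n = 2 * tri n + n" by (induction n) auto
    have e1: "K * tri n + (K - i) * n = k * n * n + c * n + tri (Suc n)"
    proof -
      have "k * n * n = k * (2 * tri n + n)" using nn by (simp add: mult.assoc)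
      then show ?thesis unfolding Ki K_def by (simp add: k algebra_simps)
    qed
    have e2: "K * tri (Suc n) + i * Suc n = k * n * n + c * n + tri (Suc n) + (2 * n + 1) * i"
    proof -
      have "k * n * n = k * (2 * tri n + n)" using nn by (simp add: mult.assoc)
      then show ?thesis unfolding K_def by (simp add: k algebra_simps)
    qed
    have "Y n = (-1) ^ n * q ^ (k * n * n + c * n + tri (Suc n))"
      unfolding e1[symmetric] Y_def p by (simp only: y_def power_add power_mult mult.assoc)
    moreover have "X (Suc n) = - ((-1) ^ n * q ^ (k * n * n + c * n + tri (Suc n) + (2 * n + 1) * i))"
      unfolding e2[symmetric] X_def p by (simp only: x_def power_add power_mult mult.assoc power_Suc[of "-1"] minus_mult_left[symmetric] mult_1_left)
    ultimately show ?thesis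
      unfolding andrews_term_def c_def[symmetric] by (simp add: power_add right_diff_distrib mult.assoc)
  qed
  have "andrews_sum q k i 0 N = (\<Sum>n<N. Y n + X (Suc n))"
    by (simp add: andrews_sum_def split)
  also have "\<dots> = (1 + (\<Sum>n<N. X (Suc n) + Y (Suc n))) - Y N"
    by (induction N) (simp_all add: Y_def)
  also have "rcong (q ^ N) \<dots> (1 + (\<Sum>n<N. X (Suc n) + Y (Suc n)) - 0)"
  proof (intro rcong_diff rcong_refl)
    have "q dvd y"
      unfolding y_def using K by (intro dvd_power) auto
    then have "q ^ N dvd y ^ N"
      by (rule dvd_power_same)
    then show "rcong (q ^ N) (Y N) 0"
      by (simp add: Y_def rcong_def)
  qed
  also have "1 + (\<Sum>n<N. X (Suc n) + Y (Suc n)) - 0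
      = 1 + (\<Sum>n<N. (-1) ^ Suc n * (x * y) ^ tri (Suc n) * (x ^ Suc n + y ^ Suc n))"
    unfolding X_def Y_def distrib_left diff_0_right ..
  also have "rcong (q ^ N) \<dots> (\<Prod>j<N. (1 - x * (x * y) ^ j) * (1 - y * (x * y) ^ j) * (1 - (x * y) ^ Suc j))"
  proof (rule rcong_dvd[OF rcong_sym[OF truncated_triple_product]])
    show "x \<noteq> 0" "y \<noteq> 0"
      using assms by (auto simp: x_def y_def)
    show "q ^ N dvd (x * y) ^ N"
      unfolding p using K by (intro dvd_power_same dvd_power) auto
  qed
  also have "\<dots> = (\<Prod>j<N. (1 - q ^ (K * j + i)) * (1 - q ^ (K * j + (K - i))) * (1 - q ^ (K * Suc j)))"
    unfolding p by (simp only: x_def y_def power_add[symmetric] power_mult[symmetric] add.commute)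
  finally show ?thesis .
qed

section \<open>Generating functions of partitions\<close>

lemma rcong_fps_X_power_iff:
  fixes f g :: "'a::comm_ring_1 fps"
  shows "rcong (fps_X ^ N) f g \<longleftrightarrow> (\<forall>n<N. fps_nth f n = fps_nth g n)"
proof
  assume "rcong (fps_X ^ N) f g"
  then obtain h where "f - g = fps_X ^ N * h"
    by (auto simp: rcong_def)
  then have "fps_nth (f - g) n = 0" if "n < N" for n
    using that by (simp add: fps_X_power_mult_nth)
  then show "\<forall>n<N. fps_nth f n = fps_nth g n" by simp
next
  assume "\<forall>n<N. fps_nth f n = fps_nth g n"
  then have "f - g = fps_X ^ N * Abs_fps (\<lambda>n. fps_nth (f - g) (n + N))"
    by (intro fps_ext) (simp add: fps_X_power_mult_nth)
  then show "rcong (fps_X ^ N) f g"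
    unfolding rcong_def by (rule dvdI)
qed

definition partition_gf :: "(nat multiset \<Rightarrow> bool) \<Rightarrow> int fps" where
  "partition_gf R = Abs_fps (\<lambda>n. int (card {P \<in> partitions_of n. R P}))"

text \<open>
  Partitions that contain the multiset \<^term>\<open>M\<close> arise from arbitrary ones by adding \<^term>\<open>M\<close>, which
  shifts the generating function by the sum of \<^term>\<open>M\<close>.
\<close>

lemma partition_gf_split:
  assumes split: "\<And>P. R P \<longleftrightarrow> R1 P \<or> (M \<subseteq># P \<and> R2 (P - M))"
    and disj: "\<And>P. R1 P \<Longrightarrow> M \<subseteq># P \<Longrightarrow> R2 (P - M) \<Longrightarrow> False"
    and pos: "\<And>p. p \<in># M \<Longrightarrow> 0 < p"
  shows "partition_gf R = partition_gf R1 + fps_X ^ \<Sum>\<^sub># M * partition_gf R2"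
proof (rule fps_ext)
  fix n
  define S1 where "S1 = {P \<in> partitions_of n. R1 P}"
  define S2 where "S2 = {P \<in> partitions_of n. M \<subseteq># P \<and> R2 (P - M)}"
  have "{P \<in> partitions_of n. R P} = S1 \<union> S2"
    using split by (auto simp: S1_def S2_def)
  moreover have "finite S1" "finite S2" "S1 \<inter> S2 = {}"
    using disj by (auto simp: S1_def S2_def finite_partitions_of)
  ultimately have card: "card {P \<in> partitions_of n. R P} = card S1 + card S2"
    by (simp add: card_Un_disjoint)
  have S2: "card S2 = (if n < \<Sum>\<^sub># M then 0 else card {P \<in> partitions_of (n - \<Sum>\<^sub># M). R2 P})"
  proof (cases "n < \<Sum>\<^sub># M")
    case True
    have "\<Sum>\<^sub># M \<le> \<Sum>\<^sub># P" if "M \<subseteq># P" for P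
      using that by (metis le_add1 subset_mset.le_iff_add sum_mset.union)
    then have "S2 = {}"
      using True by (fastforce simp: S2_def partitions_of_def)
    then show ?thesis using True by simp
  next
    case False
    have "bij_betw (\<lambda>P. M + P) {P \<in> partitions_of (n - \<Sum>\<^sub># M). R2 P} S2"
    proof (rule bij_betw_byWitness[where f' = "\<lambda>P. P - M"])
      show "(\<lambda>P. M + P) ` {P \<in> partitions_of (n - \<Sum>\<^sub># M). R2 P} \<subseteq> S2"
        using False pos by (auto simp: S2_def partitions_of_def)
      show "(\<lambda>P. P - M) ` S2 \<subseteq> {P \<in> partitions_of (n - \<Sum>\<^sub># M). R2 P}"
        by (auto simp: S2_def partitions_of_def sum_mset_diff dest: in_diffD)
    qed (auto simp: S2_def)
    then have "card {P \<in> partitions_of (n - \<Sum>\<^sub># M). R2 P} = card S2"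
      by (rule bij_betw_same_card)
    then show ?thesis
      using False by simp
  qed
  show "fps_nth (partition_gf R) n = fps_nth (partition_gf R1 + fps_X ^ \<Sum>\<^sub># M * partition_gf R2) n"
    by (simp add: partition_gf_def card S2 S1_def fps_X_power_mult_nth)
qed

lemma rcong_partition_gf:
  assumes "\<And>n P. n < N \<Longrightarrow> P \<in> partitions_of n \<Longrightarrow> R P \<longleftrightarrow> R' P"
  shows "rcong (fps_X ^ N) (partition_gf R) (partition_gf R')"
  unfolding rcong_fps_X_power_iff partition_gf_def using assms
  by (auto intro!: arg_cong[where f = card])

lemma partitions_of_part_bounds:
  assumes "P \<in> partitions_of n" "p \<in># P"
  shows "0 < p" "p \<le> n"
  using assms by (auto simp: partitions_of_def dest!: multi_member_split)

definition parts_gf :: "nat set \<Rightarrow> int fps" where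
  "parts_gf A = partition_gf (\<lambda>P. set_mset P \<subseteq> A)"

lemma parts_gf_empty: "parts_gf {} = 1"
proof (rule fps_ext)
  fix n
  have "{P \<in> partitions_of n. set_mset P \<subseteq> {}} = (if n = 0 then {{#}} else {})"
    by (auto simp: partitions_of_def)
  then show "fps_nth (parts_gf {}) n = fps_nth 1 n"
    by (simp add: parts_gf_def partition_gf_def)
qed

lemma parts_gf_remove:
  assumes "s \<in> A" "0 < s"
  shows "parts_gf A * (1 - fps_X ^ s) = parts_gf (A - {s})"
proof -
  have "parts_gf A = parts_gf (A - {s}) + fps_X ^ \<Sum>\<^sub># {#s#} * parts_gf A"
    unfolding parts_gf_def
  proof (rule partition_gf_split)
    fix P
    show "set_mset P \<subseteq> A \<longleftrightarrow> set_mset P \<subseteq> A - {s} \<or> ({#s#} \<subseteq># P \<and> set_mset (P - {#s#}) \<subseteq> A)"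
    proof (cases "s \<in># P")
      case True
      then obtain P' where "P = add_mset s P'"
        by (metis insert_DiffM)
      then show ?thesis using assms by auto
    qed auto
  qed (use assms in auto)
  then show ?thesis
    by (simp add: algebra_simps)
qed

lemma parts_gf_remove_finite:
  assumes "finite F" "F \<subseteq> A" "0 \<notin> F"
  shows "parts_gf A * (\<Prod>s\<in>F. 1 - fps_X ^ s) = parts_gf (A - F)"
  using assms
proof (induction F rule: finite_induct)
  case empty
  then show ?case by simp
next
  case (insert s F)
  have "parts_gf A * (\<Prod>s\<in>insert s F. 1 - fps_X ^ s) = parts_gf (A - F) * (1 - fps_X ^ s)"
    using insert by (simp add: mult_ac)
  also have "\<dots> = parts_gf (A - F - {s})"
    using insert by (intro parts_gf_remove) auto
  also have "A - F - {s} = A - insert s F" by auto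
  finally show ?case .
qed

text \<open>
  The truncated form of $\sum_n p_A(n) X^n = \prod_{s\in A} (1 - X^s)^{-1}$: once all parts up to
  \<^term>\<open>M\<close> are removed, only the empty partition contributes up to degree \<^term>\<open>M\<close>.
\<close>

lemma parts_gf_prod_rcong_1:
  "rcong (fps_X ^ Suc M) (parts_gf A * (\<Prod>s\<in>A \<inter> {1..M}. 1 - fps_X ^ s)) 1"
proof -
  have "parts_gf A * (\<Prod>s\<in>A \<inter> {1..M}. 1 - fps_X ^ s) = parts_gf (A - A \<inter> {1..M})"
    by (intro parts_gf_remove_finite) auto
  also have "rcong (fps_X ^ Suc M) \<dots> (parts_gf {})"
    unfolding parts_gf_def
  proof (intro rcong_partition_gf)
    fix n P
    assume n: "n < Suc M" and P: "P \<in> partitions_of n"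
    have "p \<in> {1..M}" if "p \<in># P" for p
      using partitions_of_part_bounds[OF P that] n by simp
    then show "set_mset P \<subseteq> A - A \<inter> {1..M} \<longleftrightarrow> set_mset P \<subseteq> {}"
      by blast
  qed
  finally show ?thesis
    by (simp only: parts_gf_empty)
qed

section \<open>Gordon partitions\<close>

text \<open>
  Gordon's condition imposed on the multiples of \<^term>\<open>d\<close> alone; all other parts are free. The level
  \<^term>\<open>m\<close> is the number of smallest multiples of \<^term>\<open>d\<close> that are excluded, and \<^term>\<open>i\<close> bounds the
  multiplicity of the next one. Strict bounds make the class empty for \<^term>\<open>i = (0::nat)\<close>, which starts
  the recurrence.
\<close>

definition gordon :: "nat \<Rightarrow> nat \<Rightarrow> nat \<Rightarrow> nat \<Rightarrow> nat multiset \<Rightarrow> bool" where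
  "gordon d k i m P \<longleftrightarrow> (\<forall>j\<in>{1..m}. count P (d * j) = 0) \<and> count P (d * Suc m) < i \<and>
     (\<forall>j\<ge>1. count P (d * j) + count P (d * Suc j) < k)"

lemma partition_gf_gordon_0: "partition_gf (gordon d k 0 m) = 0"
  by (rule fps_ext) (simp add: partition_gf_def gordon_def)

text \<open>
  If $d(m+1)$ appears exactly \<^term>\<open>c\<close> times, then the pair condition leaves at most $k - 1 - c$ copies
  of $d(m+2)$, and this is all that the removed copies still impose on the remaining parts.
\<close>

lemma gordon_remove_smallest:
  assumes "0 < d" "c < k" "count P (d * Suc m) = c"
  defines "P' \<equiv> P - replicate_mset c (d * Suc m)"
  shows "gordon d k (Suc c) m P \<longleftrightarrow> gordon d k (k - c) (Suc m) P'"
proof -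
  define f where "f = (\<lambda>j. count P (d * j))"
  define g where "g = (\<lambda>j. count P' (d * j))"
  have g: "g j = (if j = Suc m then 0 else f j)" for j
  proof -
    have "g j = f j - (if d * j = d * Suc m then c else 0)"
      unfolding g_def f_def P'_def count_diff count_replicate_mset ..
    moreover have "d * j = d * Suc m \<longleftrightarrow> j = Suc m"
      using assms(1) by (simp del: mult_Suc_right)
    ultimately show ?thesis
      using assms(3) by (auto simp: f_def)
  qed
  have fc: "f (Suc m) = c"
    using assms by (simp add: f_def)
  have pair: "f j + f (Suc j) < k"
    if 0: "\<forall>j\<in>{1..Suc m}. g j = 0" and 1: "g (Suc (Suc m)) < k - c"
      and 2: "\<forall>j\<ge>1. g j + g (Suc j) < k" and "1 \<le> j" for j
  proof -
    consider "j = m" | "j = Suc m" | "j \<noteq> m" "j \<noteq> Suc m" by blast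
    then show ?thesis
    proof cases
      case 1
      then have "g m = 0" using 0 \<open>1 \<le> j\<close> by auto
      then show ?thesis using 1 g[of m] fc \<open>c < k\<close> by simp
    next
      case 2
      then show ?thesis using 1 g[of "Suc (Suc m)"] fc by simp
    next
      case 3
      then show ?thesis using 2 \<open>1 \<le> j\<close> g[of j] g[of "Suc j"] by force
    qed
  qed
  have "(\<forall>j\<in>{1..m}. f j = 0) \<and> f (Suc m) < Suc c \<and> (\<forall>j\<ge>1. f j + f (Suc j) < k) \<longleftrightarrow>
        (\<forall>j\<in>{1..Suc m}. g j = 0) \<and> g (Suc (Suc m)) < k - c \<and> (\<forall>j\<ge>1. g j + g (Suc j) < k)"
    (is "?F \<longleftrightarrow> ?G")
  proof
    assume F: ?F
    have "f (Suc m) + f (Suc (Suc m)) < k" using F by simp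
    then have "g (Suc (Suc m)) < k - c" using fc g[of "Suc (Suc m)"] by simp
    moreover have "g j + g (Suc j) < k" if "1 \<le> j" for j
    proof -
      have "f j + f (Suc j) < k" using F that by simp
      then show ?thesis by (auto simp: g)
    qed
    ultimately show ?G
      using F by (auto simp: g)
  next
    assume G: ?G
    have "f j = 0" if "j \<in> {1..m}" for j
    proof -
      have "g j = 0" using G that by auto
      then show ?thesis using that by (auto simp: g split: if_splits)
    qed
    then show ?F
      using pair G fc by blast
  qed
  then show ?thesis
    by (simp only: gordon_def f_def g_def)
qed

text \<open>
  A partition counted for \<^term>\<open>i\<close> either has fewer than \<^term>\<open>i - 1\<close> copies of the smallest
  permitted multiple of \<^term>\<open>d\<close>, or exactly \<^term>\<open>i - 1\<close> copies, which are then removed. This is the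
  recurrence of Andrews' sums with $q = X^d$.
\<close>

lemma partition_gf_gordon_recurrence:
  assumes "0 < d" "1 \<le> i" "i \<le> k"
  shows "partition_gf (gordon d k i m) = partition_gf (gordon d k (i - 1) m)
     + (fps_X ^ d) ^ (Suc m * (i - 1)) * partition_gf (gordon d k (k + 1 - i) (Suc m))"
proof -
  define c where "c = i - 1"
  define M where "M = replicate_mset c (d * Suc m)"
  have i: "i = Suc c" "c < k" using assms by (auto simp: c_def)
  have count: "count P (d * Suc m) = c" if "M \<subseteq># P" "gordon d k (k - c) (Suc m) (P - M)" for P
  proof -
    have "c \<le> count P (d * Suc m)"
      using that(1) by (simp add: M_def count_le_replicate_mset_subset_eq)
    moreover have "\<forall>j\<in>{1..Suc m}. count (P - M) (d * j) = 0"
      using that(2) unfolding gordon_def by blast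
    then have "count (P - M) (d * Suc m) = 0"
      by (rule bspec) simp
    ultimately show ?thesis
      by (simp add: M_def)
  qed
  have "partition_gf (gordon d k (Suc c) m) = partition_gf (gordon d k c m)
     + fps_X ^ \<Sum>\<^sub># M * partition_gf (gordon d k (k - c) (Suc m))"
  proof (rule partition_gf_split)
    fix P
    have "gordon d k (Suc c) m P \<longleftrightarrow> gordon d k c m P \<or>
        (count P (d * Suc m) = c \<and> gordon d k (Suc c) m P)"
      by (auto simp: gordon_def)
    also have "count P (d * Suc m) = c \<and> gordon d k (Suc c) m P \<longleftrightarrow>
        M \<subseteq># P \<and> gordon d k (k - c) (Suc m) (P - M)"
    proof -
      have "M \<subseteq># P \<longleftrightarrow> c \<le> count P (d * Suc m)"
        by (simp only: M_def count_le_replicate_mset_subset_eq)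
      moreover have "gordon d k (Suc c) m P \<longleftrightarrow> gordon d k (k - c) (Suc m) (P - M)"
        if "count P (d * Suc m) = c"
        using gordon_remove_smallest[OF assms(1) i(2) that] by (simp only: M_def)
      ultimately show ?thesis
        using count[of P] by (metis order_refl)
    qed
    finally show "gordon d k (Suc c) m P \<longleftrightarrow> gordon d k c m P \<or>
        (M \<subseteq># P \<and> gordon d k (k - c) (Suc m) (P - M))" .
    assume "gordon d k c m P" "M \<subseteq># P" "gordon d k (k - c) (Suc m) (P - M)"
    then show False
      using count[of P] by (auto simp: gordon_def)
  qed (use assms in \<open>auto simp: M_def split: if_splits\<close>)
  moreover have "\<Sum>\<^sub># M = d * (Suc m * c)"
    by (simp add: M_def algebra_simps)
  ultimately show ?thesis
    by (simp add: i power_mult)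
qed

text \<open>
  Below degree \<^term>\<open>d * N\<close> the level \<^term>\<open>N\<close> excludes every multiple of \<^term>\<open>d\<close>.
\<close>

lemma partition_gf_gordon_initial:
  assumes "0 < d" "1 \<le> i" "i \<le> k"
  shows "rcong (fps_X ^ (d * N)) (partition_gf (gordon d k i N)) (parts_gf {p. \<not> d dvd p})"
  unfolding parts_gf_def
proof (intro rcong_partition_gf)
  fix n P
  assume n: "n < d * N" and P: "P \<in> partitions_of n"
  have le: "0 < p \<and> p \<le> n" if "p \<in># P" for p
    using partitions_of_part_bounds[OF P that] by simp
  show "gordon d k i N P \<longleftrightarrow> set_mset P \<subseteq> {p. \<not> d dvd p}"
  proof
    assume G: "gordon d k i N P"
    have False if "p \<in># P" "d dvd p" for p
    proof -
      obtain j where j: "p = d * j" using \<open>d dvd p\<close> by blast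
      then have "d * j < d * N" "0 < d * j" using le[OF that(1)] n by linarith+
      then have "j < N" "0 < j" by simp_all
      then have "count P (d * j) = 0"
        using G by (auto simp: gordon_def)
      then show False using that(1) j by (simp add: count_eq_zero_iff)
    qed
    then show "set_mset P \<subseteq> {p. \<not> d dvd p}" by blast
  next
    assume "set_mset P \<subseteq> {p. \<not> d dvd p}"
    then have "count P (d * j) = 0" for j
      by (subst count_eq_zero_iff) auto
    then show "gordon d k i N P"
      using assms by (simp add: gordon_def del: mult_Suc_right)
  qed
qed

text \<open>
  The factors of the triple product in $q = X^d$ run exactly through the residue classes that
  Gordon's theorem excludes.
\<close>

lemma prod_theta_residues:
  fixes X :: "'a::comm_ring_1"
  assumes "0 < d" "1 \<le> i" "2 * i < K"
  shows "(\<Prod>s | s \<in> {1..d * K * N} \<and> s mod (d * K) \<in> {0, d * i, d * (K - i)}. 1 - X ^ s) =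
    (\<Prod>j<N. (1 - (X ^ d) ^ (K * j + i)) * (1 - (X ^ d) ^ (K * j + (K - i))) * (1 - (X ^ d) ^ (K * Suc j)))"
proof -
  define h where "h = (\<lambda>r j. d * (K * j + r))"
  define B where "B = (\<lambda>r. h r ` {..<N})"
  have hmod: "h r j mod (d * K) = d * (r mod K)" for r j
    by (simp add: h_def flip: mult_mod_right)
  have iK: "0 < i" "i < K - i" "K - i < K" using assms by auto
  have "d * K > 0" using assms by simp
  have hle: "h r j \<in> {1..d * K * N}" if "j < N" "0 < r" "r \<le> K" for r j
  proof -
    have "K * j + r \<le> K * Suc j" using that by simp
    also have "\<dots> \<le> K * N" using that by (intro mult_le_mono) auto
    finally have "d * (K * j + r) \<le> d * (K * N)" by (rule mult_le_mono2)
    moreover have "0 < d * (K * j + r)" using that assms by simp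
    ultimately show ?thesis unfolding h_def mult.assoc atLeastAtMost_iff by linarith
  qed
  have set_eq: "{s. s \<in> {1..d * K * N} \<and> s mod (d * K) \<in> {0, d * i, d * (K - i)}} = B i \<union> B (K - i) \<union> B K"
    (is "?S = _")
  proof (intro equalityI subsetI)
    fix s assume s: "s \<in> ?S"
    define j where "j = s div (d * K)"
    have sj: "s = d * K * j + s mod (d * K)" by (simp add: j_def)
    consider "s mod (d * K) = 0" | r where "r = i \<or> r = K - i" "s mod (d * K) = d * r" using s by auto
    then show "s \<in> B i \<union> B (K - i) \<union> B K"
    proof cases
      case 1
      with sj have sj': "s = d * K * j" by simp
      then obtain j' where j: "j = Suc j'" using s by (cases j) auto
      have "j \<le> N" using s sj' \<open>d * K > 0\<close> by simp
      then have "s = h K j'" "j' < N" using sj' j by (auto simp: h_def algebra_simps)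
      then show ?thesis by (auto simp: B_def)
    next
      case 2
      have "0 < d * r" using 2 iK assms by auto
      moreover have "s = d * K * j + d * r" using sj 2(2) by simp
      moreover have "s \<le> d * K * N" using s by simp
      ultimately have "d * K * j < d * K * N" by linarith
      then have "j < N" by simp
      moreover have "s = h r j" using sj 2 by (simp add: h_def algebra_simps)
      ultimately show ?thesis using 2(1) by (auto simp: B_def)
    qed
  next
    fix s assume "s \<in> B i \<union> B (K - i) \<union> B K"
    then obtain r j where "s = h r j" "j < N" "r = i \<or> r = K - i \<or> r = K"
      by (auto simp: B_def)
    then show "s \<in> ?S"
      using hle[of j r] hmod[of r j] iK by auto
  qed
  have disj: "B r \<inter> B r' = {}" if "r mod K \<noteq> r' mod K" for r r'
  proof -
    have "h r j \<noteq> h r' j'" for j j'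
      using hmod[of r j] hmod[of r' j'] that assms by auto
    then show ?thesis by (auto simp: B_def)
  qed
  have inj: "inj_on (h r) {..<N}" for r
    using assms by (auto simp: inj_on_def h_def)
  have prodB: "(\<Prod>s\<in>B r. 1 - X ^ s) = (\<Prod>j<N. 1 - (X ^ d) ^ (K * j + r))" for r
    unfolding B_def by (subst prod.reindex[OF inj]) (simp add: h_def power_mult)
  have "(\<Prod>s\<in>B i \<union> B (K - i) \<union> B K. 1 - X ^ s)
      = (\<Prod>s\<in>B i. 1 - X ^ s) * (\<Prod>s\<in>B (K - i). 1 - X ^ s) * (\<Prod>s\<in>B K. 1 - X ^ s)"
    using disj[of i "K - i"] disj[of i K] disj[of "K - i" K] iK
    by (subst prod.union_disjoint; (subst prod.union_disjoint)?) (auto simp: B_def)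
  also have "\<dots> = (\<Prod>j<N. (1 - (X ^ d) ^ (K * j + i)) * (1 - (X ^ d) ^ (K * j + (K - i))) * (1 - (X ^ d) ^ (K * Suc j)))"
    by (simp add: prodB prod.distrib add.commute)
  finally show ?thesis
    unfolding set_eq .
qed

section \<open>Gordon's theorem\<close>

text \<open>
  For \<^term>\<open>d = (1::nat)\<close> this is Gordon's generalization of the Rogers-Ramanujan identities. Multiplied
  by \<open>all\<close>, the truncation of $\prod_s (1 - X^s)$, the generating functions of the partitions
  satisfying \<^const>\<open>gordon\<close> become Andrews' sums in $q = X^d$: the factors whose exponent is not a
  multiple of \<^term>\<open>d\<close> cancel the free parts, and the others supply $(q;q)_\infty$.
\<close>

theorem dilated_gordon:
  assumes "0 < d" "1 \<le> i" "i \<le> k"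
  defines "K \<equiv> 2 * k + 1"
  shows "partition_gf (gordon d k i 0) = parts_gf {p. p mod (d * K) \<notin> {0, d * i, d * (K - i)}}"
proof -
  define A where "A = {p. p mod (d * K) \<notin> {0, d * i, d * (K - i)}}"
  have K: "2 * i < K" "1 \<le> K" using assms by (auto simp: K_def)
  have main: "rcong (fps_X ^ (d * N)) (partition_gf (gordon d k i 0)) (parts_gf A)" for N
  proof -
    define Q :: "int fps" where "Q = fps_X ^ d"
    \<comment> \<open>a whole number of periods of the residue classes, so that the triple product comes out complete\<close>
    define M where "M = d * K * N"
    define E :: "nat \<Rightarrow> int fps" where "E = (\<lambda>s. 1 - fps_X ^ s)"
    define all where "all = prod E {1..M}"
    have QN: "Q ^ N = fps_X ^ (d * N)" by (simp add: Q_def power_mult)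
    have Q0: "Q \<noteq> 0" by (simp add: Q_def)
    have split: "all = prod E (S \<inter> {1..M}) * prod E ({1..M} - S)" for S
      unfolding all_def using prod.Int_Diff[of "{1..M}" E S] by (simp add: Int_commute)
    have "d * N \<le> M"
      using K by (simp add: M_def)
    then have dM: "fps_X ^ (d * N) dvd (fps_X ^ Suc M :: int fps)"
      by (intro le_imp_power_dvd) simp
    have parts1: "rcong (Q ^ N) (parts_gf S * all) (prod E ({1..M} - S))" for S
    proof -
      have "rcong (Q ^ N) (parts_gf S * prod E (S \<inter> {1..M})) 1"
        unfolding QN E_def by (rule rcong_dvd[OF parts_gf_prod_rcong_1 dM])
      from rcong_mult[OF this rcong_refl[of _ "prod E ({1..M} - S)"]] show ?thesis
        unfolding split[of S] by (simp add: mult.assoc)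
    qed
    have multiples: "prod E ({1..M} - {p. \<not> d dvd p}) = qprod Q 0 (K * N)"
    proof -
      have "{1..M} - {p. \<not> d dvd p} = (\<lambda>j. d * Suc j) ` {..<K * N}" (is "_ = ?R")
      proof (intro equalityI subsetI)
        fix s assume "s \<in> {1..M} - {p. \<not> d dvd p}"
        then obtain t where t: "s = d * t" "0 < d * t" "d * t \<le> d * (K * N)"
          by (auto simp: M_def mult.assoc)
        then have "s = d * Suc (t - 1)" "t - 1 < K * N" using assms by auto
        then show "s \<in> ?R" by blast
      next
        fix s assume "s \<in> ?R"
        then obtain j where "j < K * N" "s = d * Suc j" by blast
        then have "s = d * Suc j" "Suc j \<le> K * N" by auto
        then show "s \<in> {1..M} - {p. \<not> d dvd p}"
          using assms by (auto simp: M_def mult.assoc simp del: mult_Suc_right)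
      qed
      moreover have "inj_on (\<lambda>j. d * Suc j) {..<K * N}"
        using assms by (auto simp: inj_on_def)
      ultimately show ?thesis
        by (simp add: prod.reindex qprod_def E_def Q_def flip: power_mult power_Suc)
    qed
    have "rcong (Q ^ N) (partition_gf (gordon d k i 0) * all) (andrews_sum Q k i 0 N)"
    proof (rule recurrence_unique[where k = k and q = Q and N = N
          and f = "\<lambda>i m. partition_gf (gordon d k i m) * all" and g = "\<lambda>i m. andrews_sum Q k i m N"])
      fix i' assume i': "1 \<le> i'" "i' \<le> k"
      have "rcong (Q ^ N) (partition_gf (gordon d k i' N) * all) (parts_gf {p. \<not> d dvd p} * all)"
        unfolding QN using assms i' by (intro rcong_mult rcong_refl partition_gf_gordon_initial)
      also have "rcong (Q ^ N) \<dots> (prod E ({1..M} - {p. \<not> d dvd p}))"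
        by (rule parts1)
      also have "\<dots> = qprod Q 0 (K * N)"
        by (rule multiples)
      also have "rcong (Q ^ N) \<dots> (qprod Q 0 N)"
        using K by (intro rcong_qprod) (auto simp: le_Suc_eq)
      also have "rcong (Q ^ N) \<dots> (andrews_sum Q k i' N N)"
        using i' by (rule rcong_sym[OF andrews_sum_initial])
      finally show "rcong (Q ^ N) (partition_gf (gordon d k i' N) * all) (andrews_sum Q k i' N N)" .
    next
      fix m
      show "rcong (Q ^ N) (partition_gf (gordon d k 0 m) * all) (andrews_sum Q k 0 m N)"
        by (simp add: partition_gf_gordon_0)
    next
      fix i' m assume "1 \<le> i'" "i' \<le> k"
      then show "rcong (Q ^ N) (partition_gf (gordon d k i' m) * all)
          (partition_gf (gordon d k (i' - 1) m) * all
           + Q ^ (Suc m * (i' - 1)) * (partition_gf (gordon d k (k + 1 - i') (Suc m)) * all))"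
        using assms by (subst partition_gf_gordon_recurrence) (simp_all add: Q_def algebra_simps)
    next
      fix i' m assume "1 \<le> i'" "i' \<le> k"
      then show "rcong (Q ^ N) (andrews_sum Q k i' m N)
          (andrews_sum Q k (i' - 1) m N + Q ^ (Suc m * (i' - 1)) * andrews_sum Q k (k + 1 - i') (Suc m) N)"
        by (rule andrews_sum_recurrence)
    qed (use assms in auto)
    also have "rcong (Q ^ N) \<dots> (\<Prod>j<N. (1 - Q ^ (K * j + i)) * (1 - Q ^ (K * j + (K - i))) * (1 - Q ^ (K * Suc j)))"
      unfolding K_def using Q0 assms by (intro andrews_sum_triple_product)
    also have "\<dots> = prod E ({1..M} - A)"
    proof -
      have "{1..M} - A = {s. s \<in> {1..d * K * N} \<and> s mod (d * K) \<in> {0, d * i, d * (K - i)}}"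
        by (auto simp: M_def A_def)
      then show ?thesis
        unfolding E_def Q_def using assms(1,2) K(1) by (simp only: prod_theta_residues)
    qed
    also have "rcong (Q ^ N) \<dots> (parts_gf A * all)"
      by (rule rcong_sym[OF parts1])
    finally have "rcong (fps_X ^ (d * N)) (all * partition_gf (gordon d k i 0)) (all * parts_gf A)"
      unfolding QN by (simp add: mult.commute)
    moreover have "rcong fps_X all 1"
    proof -
      have "rcong (fps_X :: int fps) (prod E {1..M}) (\<Prod>s\<in>{1..M}. 1)"
        by (intro rcong_prod) (auto simp: E_def rcong_def intro!: dvd_power)
      then show ?thesis by (simp add: all_def)
    qed
    ultimately show ?thesis
      by (rule rcong_cancel_one_minus[rotated])
  qed
  show ?thesis
  proof (rule fps_ext)
    fix n
    \<comment> \<open>the precision of the congruence is chosen to exceed the degree of the coefficient\<close>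
    have "n < d * Suc n" using assms by (cases d) auto
    then show "fps_nth (partition_gf (gordon d k i 0)) n =
        fps_nth (parts_gf {p. p mod (d * K) \<notin> {0, d * i, d * (K - i)}}) n"
      using main[of "Suc n"] unfolding rcong_fps_X_power_iff A_def by blast
  qed
qed

section \<open>Odd parts without restriction\<close>

text \<open>
  The case \<^term>\<open>d = (2::nat)\<close>, \<^term>\<open>k = (3::nat)\<close>: the multiples of \<^term>\<open>d\<close> are the even numbers, and
  the modulus is $d(2k+1) = 14$.
\<close>

theorem corollary1p4:
  fixes i n :: nat
  assumes "i \<in> {1, 2, 3}"
  shows "card {P \<in> partitions_of n.
            count P 2 \<le> i - 1 \<and>
            (\<forall>j\<ge>1. count P (2 * j) + count P (2 * j + 2) \<le> 2)}
       = card {P \<in> partitions_of n.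
            \<forall>p \<in># P. \<not> [int p = 0] (mod 14) \<and>
                     \<not> [int p = 2 * int i] (mod 14) \<and>
                     \<not> [int p = - 2 * int i] (mod 14)}"
proof -
  have gordon_iff: "gordon 2 3 i 0 P \<longleftrightarrow> count P 2 \<le> i - 1 \<and>
      (\<forall>j\<ge>1. count P (2 * j) + count P (2 * j + 2) \<le> 2)" for P
    using assms by (auto simp: gordon_def less_Suc_eq_le numeral_3_eq_3 numeral_2_eq_2)
  have residue_iff: "p mod 14 \<notin> {0, 2 * i, 2 * (7 - i)} \<longleftrightarrow> \<not> [int p = 0] (mod 14) \<and>
      \<not> [int p = 2 * int i] (mod 14) \<and> \<not> [int p = - 2 * int i] (mod 14)" for p
  proof -
    have "int p mod 14 = int (p mod 14)" by (simp add: zmod_int)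
    then show ?thesis
      using assms by (auto simp: cong_def)
  qed
  have "fps_nth (partition_gf (gordon 2 3 i 0)) n
      = fps_nth (parts_gf {p. p mod 14 \<notin> {0, 2 * i, 2 * (7 - i)}}) n"
    using dilated_gordon[of 2 i 3] assms by auto
  then show ?thesis
    by (simp only: partition_gf_def parts_gf_def fps_nth_Abs_fps of_nat_eq_iff gordon_iff
        subset_iff mem_Collect_eq residue_iff Ball_def)
qed

end
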